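(* Let $n\ge 2$. For every permutation $\tau$ of $[n]$ and every $\mathbf k=(k_1,\dots,k_n)\in\{0,\dots,n-1\}^n$, $$E_n(k_1,\dots,k_n)=E_n(k_{\tau(1)},\dots,k_{\tau(n)}).$$ In particular, $E_n(k_1,\dots,k_n)$ depends only on the multiset $\{k_1,\dots,k_n\}$.
   Context: $[n]=\{1,\dots,n\}$. An order-$n$ Latin square is an $n\times n$ matrix $L=(L(i,j))_{1\le i,j\le n}$ with entries in $[n]$ such that every row and every column is a permutation of $[n]$. An ascent of a permutation $\pi$ of $[n]$ is an index $i\in\{1,\dots,n-1\}$ with $\pi(i)<\pi(i+1)$. For a Latin square $L$ and $1\le i\le n$, $k_i(L)\in\{0,\dots,n-1\}$ is the number of ascents of the $i$-th column $(L(1,i),L(2,i),\dots,L(n,i))$ viewed as a permutation of $[n]$. For $\mathbf k=(k_1,\dots,k_n)\in\{0,\dots,n-1\}^n$, the Latin Eulerian number $E_n(k_1,\dots,k_n)$ is the number of order-$n$ Latin squares $L$ with $k_i(L)=k_i$ for all $i=1,\dots,n$. *)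

theory Defs
  imports "HOL-Library.FuncSet" "HOL-Library.Multiset" "HOL-Combinatorics.Permutations"
begin

text \<open>Matrices are indexed by \<open>{1..n}\<close> and are extensional in both arguments, so that each
  Latin square is represented by exactly one function and counting with \<open>card\<close> is meaningful.\<close>

definition latin_squares :: "nat \<Rightarrow> (nat \<Rightarrow> nat \<Rightarrow> nat) set" where
  "latin_squares n =
    {L \<in> {1..n} \<rightarrow>\<^sub>E {1..n} \<rightarrow>\<^sub>E {1..n}.
      (\<forall>i\<in>{1..n}. bij_betw (\<lambda>j. L i j) {1..n} {1..n}) \<and>
      (\<forall>j\<in>{1..n}. bij_betw (\<lambda>i. L i j) {1..n} {1..n})}"

definition num_ascents :: "nat \<Rightarrow> (nat \<Rightarrow> nat) \<Rightarrow> nat" where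
  "num_ascents n \<pi> = card {i \<in> {1..n - 1}. \<pi> i < \<pi> (i + 1)}"

definition column_ascents :: "nat \<Rightarrow> (nat \<Rightarrow> nat \<Rightarrow> nat) \<Rightarrow> nat \<Rightarrow> nat" where
  "column_ascents n L j = num_ascents n (\<lambda>i. L i j)"

text \<open>The tuple \<open>(k\<^sub>1, \<dots>, k\<^sub>n)\<close> is a function of which only the values on \<open>{1..n}\<close> matter.\<close>

definition latin_eulerian :: "nat \<Rightarrow> (nat \<Rightarrow> nat) \<Rightarrow> nat" where
  "latin_eulerian n k =
    card {L \<in> latin_squares n. \<forall>j\<in>{1..n}. column_ascents n L j = k j}"

end

theory Submission
  imports Defs
begin

text \<open>
  Permuting the columns of a Latin square gives a Latin square: each column stays the same
  permutation, only in another place, and each row is composed with a permutation. Column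
  rearrangement is invertible, and it carries the ascent profile along, so it is a bijection
  between the squares counted by the two Latin Eulerian numbers. The statement about multisets
  follows because two tuples with the same multiset of entries differ by a permutation of the
  positions.
\<close>

text \<open>
  Cutting both arguments down to \<open>{1..n}\<close> keeps the result extensional, so undoing a
  rearrangement gives back the same function and not merely the same matrix.
\<close>

definition permute_columns :: "nat \<Rightarrow> (nat \<Rightarrow> nat) \<Rightarrow> (nat \<Rightarrow> nat \<Rightarrow> nat) \<Rightarrow> nat \<Rightarrow> nat \<Rightarrow> nat" where
  "permute_columns n \<tau> L = (\<lambda>i\<in>{1..n}. \<lambda>j\<in>{1..n}. L i (\<tau> j))"

lemma permute_columns_apply:
  "i \<in> {1..n} \<Longrightarrow> j \<in> {1..n} \<Longrightarrow> permute_columns n \<tau> L i j = L i (\<tau> j)"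
  by (simp add: permute_columns_def)

lemma permute_columns_latin_square:
  assumes \<tau>: "\<tau> permutes {1..n}" and L: "L \<in> latin_squares n"
  shows "permute_columns n \<tau> L \<in> latin_squares n"
proof -
  have \<tau>_in: "\<tau> j \<in> {1..n}" if "j \<in> {1..n}" for j
    using permutes_in_image[OF \<tau>] that by blast
  have range: "L i j \<in> {1..n}" if "i \<in> {1..n}" "j \<in> {1..n}" for i j
    using L that unfolding latin_squares_def by (blast dest: PiE_mem)
  have "permute_columns n \<tau> L \<in> {1..n} \<rightarrow>\<^sub>E {1..n} \<rightarrow>\<^sub>E {1..n}"
    unfolding permute_columns_def using range \<tau>_in by (intro restrict_PiE_iff[THEN iffD2] ballI) blast
  moreover have "bij_betw (\<lambda>j. permute_columns n \<tau> L i j) {1..n} {1..n}" if "i \<in> {1..n}" for i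
  proof -
    have "bij_betw ((\<lambda>j. L i j) \<circ> \<tau>) {1..n} {1..n}"
      using L that permutes_imp_bij[OF \<tau>] unfolding latin_squares_def by (blast intro: bij_betw_trans)
    then show ?thesis
      by (rule bij_betw_cong[THEN iffD1, rotated]) (use that in \<open>simp add: permute_columns_apply\<close>)
  qed
  moreover have "bij_betw (\<lambda>i. permute_columns n \<tau> L i j) {1..n} {1..n}" if "j \<in> {1..n}" for j
  proof -
    have "bij_betw (\<lambda>i. L i (\<tau> j)) {1..n} {1..n}"
      using L \<tau>_in[OF that] unfolding latin_squares_def by blast
    then show ?thesis
      by (rule bij_betw_cong[THEN iffD1, rotated]) (use that in \<open>simp add: permute_columns_apply\<close>)
  qed
  ultimately show ?thesis
    unfolding latin_squares_def by blast
qed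

lemma column_ascents_permute_columns:
  assumes "j \<in> {1..n}"
  shows "column_ascents n (permute_columns n \<tau> L) j = column_ascents n L (\<tau> j)"
  unfolding column_ascents_def num_ascents_def
  by (rule arg_cong[of _ _ card]) (use assms in \<open>auto simp: permute_columns_apply\<close>)

lemma permute_columns_inverse:
  assumes \<sigma>: "\<sigma> permutes {1..n}" and inv: "\<And>j. \<tau> (\<sigma> j) = j" and L: "L \<in> latin_squares n"
  shows "permute_columns n \<sigma> (permute_columns n \<tau> L) = L"
proof (intro ext)
  fix i j
  have PiE: "L \<in> {1..n} \<rightarrow>\<^sub>E {1..n} \<rightarrow>\<^sub>E {1..n}"
    using L by (simp add: latin_squares_def)
  show "permute_columns n \<sigma> (permute_columns n \<tau> L) i j = L i j"
  proof (cases "i \<in> {1..n}")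
    case i: True
    then have row: "L i \<in> {1..n} \<rightarrow>\<^sub>E {1..n}"
      using PiE by (rule PiE_mem[rotated])
    show ?thesis
    proof (cases "j \<in> {1..n}")
      case True
      moreover have "\<sigma> j \<in> {1..n}"
        using True permutes_in_image[OF \<sigma>] by blast
      ultimately show ?thesis
        using i by (simp only: permute_columns_apply inv)
    next
      case False
      then have "L i j = undefined"
        using row by (rule PiE_arb[rotated])
      with i False show ?thesis
        by (simp only: permute_columns_def restrict_apply if_True if_False)
    qed
  next
    case False
    then have "L i = undefined"
      using PiE by (rule PiE_arb[rotated])
    with False show ?thesis
      by (simp only: permute_columns_def restrict_apply if_False)
  qed
qed

lemma latin_eulerian_permute:
  assumes \<tau>: "\<tau> permutes {1..n}"
  shows "latin_eulerian n k = latin_eulerian n (\<lambda>i. k (\<tau> i))"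
proof -
  define S where "S k = {L \<in> latin_squares n. \<forall>j\<in>{1..n}. column_ascents n L j = k j}" for k
  have maps: "permute_columns n \<sigma> ` S k \<subseteq> S (\<lambda>i. k (\<sigma> i))" if "\<sigma> permutes {1..n}" for \<sigma> k
    unfolding S_def using that permutes_in_image[OF that]
    by (auto simp: permute_columns_latin_square column_ascents_permute_columns simp del: atLeastAtMost_iff)
  have inv: "inv \<tau> permutes {1..n}"
    using \<tau> by (rule permutes_inv)
  have "bij_betw (permute_columns n \<tau>) (S k) (S (\<lambda>i. k (\<tau> i)))"
  proof (rule bij_betw_byWitness[where f' = "permute_columns n (inv \<tau>)"])
    show "\<forall>L\<in>S k. permute_columns n (inv \<tau>) (permute_columns n \<tau> L) = L"
      unfolding S_def using permute_columns_inverse[OF inv permutes_inverses(1)[OF \<tau>]] by blast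
    show "\<forall>L\<in>S (\<lambda>i. k (\<tau> i)). permute_columns n \<tau> (permute_columns n (inv \<tau>) L) = L"
      unfolding S_def using permute_columns_inverse[OF \<tau> permutes_inverses(2)[OF \<tau>]] by blast
    show "permute_columns n \<tau> ` S k \<subseteq> S (\<lambda>i. k (\<tau> i))"
      using \<tau> by (rule maps)
    show "permute_columns n (inv \<tau>) ` S (\<lambda>i. k (\<tau> i)) \<subseteq> S k"
      using maps[OF inv, of "\<lambda>i. k (\<tau> i)"] by (simp add: permutes_inverses(1)[OF \<tau>])
  qed
  then have "card (S k) = card (S (\<lambda>i. k (\<tau> i)))"
    by (rule bij_betw_same_card)
  then show ?thesis
    by (simp add: S_def latin_eulerian_def)
qed

lemma latin_eulerian_cong:
  "(\<And>j. j \<in> {1..n} \<Longrightarrow> k j = k' j) \<Longrightarrow> latin_eulerian n k = latin_eulerian n k'"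
  unfolding latin_eulerian_def by (simp cong: conj_cong)

theorem proposition2p5:
  fixes n :: nat
  assumes "n \<ge> 2"
  shows "(\<forall>\<tau> k. \<tau> permutes {1..n} \<longrightarrow> k \<in> {1..n} \<rightarrow> {0..n - 1} \<longrightarrow>
            latin_eulerian n k = latin_eulerian n (\<lambda>i. k (\<tau> i))) \<and>
         (\<forall>k k'. k \<in> {1..n} \<rightarrow> {0..n - 1} \<longrightarrow> k' \<in> {1..n} \<rightarrow> {0..n - 1} \<longrightarrow>
            image_mset k (mset_set {1..n}) = image_mset k' (mset_set {1..n}) \<longrightarrow>
            latin_eulerian n k = latin_eulerian n k')"
proof (intro conjI allI impI)
  fix \<tau> k :: "nat \<Rightarrow> nat"
  assume "\<tau> permutes {1..n}"
  then show "latin_eulerian n k = latin_eulerian n (\<lambda>i. k (\<tau> i))"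
    by (rule latin_eulerian_permute)
next
  fix k k' :: "nat \<Rightarrow> nat"
  assume "image_mset k (mset_set {1..n}) = image_mset k' (mset_set {1..n})"
  then obtain \<tau> where \<tau>: "\<tau> permutes {1..n}" and k: "\<forall>j\<in>{1..n}. k j = k' (\<tau> j)"
    by (rule image_mset_eq_implies_permutes[OF finite_atLeastAtMost])
  have "latin_eulerian n k = latin_eulerian n (\<lambda>i. k' (\<tau> i))"
    using k by (intro latin_eulerian_cong) blast
  also have "\<dots> = latin_eulerian n k'"
    using \<tau> by (rule latin_eulerian_permute[symmetric])
  finally show "latin_eulerian n k = latin_eulerian n k'" .
qed

end
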